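(* There are metric spaces $X$ and $Y$ which are not coarsely equivalent but such that there is an asymptotic coarse Lipschitz equivalence $f:X\to Y$ with asymptotic coarse Lipschitz inverse $g:Y\to X$ such that $\mathrm{Exp}_\infty(f\circ g)>0$ and $\mathrm{Exp}_\infty(g\circ f)>0$. In particular, both $f$ and $g$ are coarse Lipschitz embeddings and $\mathrm{AsyDim}(X)=\mathrm{AsyDim}(Y)$.
   Context: Let $(X,d)$ and $(Y,\partial)$ be metric spaces. For $f:X\to Y$ put $\omega_f(t)=\sup\{\partial(f(x),f(x')) : d(x,x')\le t\}$. The map $f$ is coarse if $\omega_f(t)<\infty$ for all $t\ge0$, and coarse Lipschitz if there is $L>0$ with $\omega_f(t)\le Lt+L$ for all $t\ge0$. Maps $f,g:X\to Y$ are close, $f\sim g$, if $\sup_{x}\partial(f(x),g(x))<\infty$. $X$ and $Y$ are coarsely equivalent if there are coarse maps $f:X\to Y$, $g:Y\to X$ with $g\circ f\sim\mathrm{Id}_X$ and $f\circ g\sim\mathrm{Id}_Y$. A coarse Lipschitz equivalence is a coarse Lipschitz map $f:X\to Y$ for which there is a coarse Lipschitz map $g:Y\to X$ with $g\circ f\sim\mathrm{Id}_X$ and $f\circ g\sim\mathrm{Id}_Y$; a coarse Lipschitz embedding is a map that is a coarse Lipschitz equivalence onto its image (with the induced metric). Maps $f,g:X\to Y$ are asymptotically close, $f\sim_\infty g$, if for some $x_0\in X$ one has $\lim_{x\to\infty}\frac{\partial(f(x),g(x))}{d(x,x_0)}=0$, where $x\to\infty$ means $d(x,x_0)\to\infty$;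 if $X$ is bounded, any two maps $X\to Y$ are by convention asymptotically close. A coarse Lipschitz map $f:X\to Y$ is an asymptotic coarse Lipschitz equivalence with asymptotic coarse Lipschitz inverse $g:Y\to X$ if $g$ is coarse Lipschitz, $g\circ f\sim_\infty\mathrm{Id}_X$ and $f\circ g\sim_\infty\mathrm{Id}_Y$. For a map $h:(X,d)\to(Z,\rho)$ and $s>0$, $\mathrm{Exp}_s(h)=\inf\{\rho(h(x),h(z))/d(x,z) : d(x,z)\ge s\}$ (with $\inf\emptyset=\infty$), and $\mathrm{Exp}_\infty(h)=\sup_{s>0}\mathrm{Exp}_s(h)$. A metric space $(X,d)$ has asymptotic dimension at most $n\in\mathbb N\cup\{0\}$ if for all $r>0$ there are families $\mathcal U_0,\ldots,\mathcal U_n$ of subsets of $X$ such that $X=\bigcup_{i=0}^n\bigcup_{U\in\mathcal U_i}U$; $\inf\{d(x,y):x\in U,y\in V\}>r$ for all $i$ and all distinct $U,V\in\mathcal U_i$; and $\sup_{U\in\mathcal U_i}\mathrm{diam}(U)<\infty$ for all $i$. $\mathrm{AsyDim}(X)$ is the minimal such $n$. *)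

theory Defs
  imports
    "HOL-Analysis.Analysis"
    "HOL-Library.Going_To_Filter"
    "HOL-Library.Extended_Nat"
begin

text \<open>
  Metric spaces are elements of the library type \<open>'a metric\<close>, with point set \<open>mspace X\<close> and distance
  \<open>mdist X\<close>. A map \<open>X \<rightarrow> Y\<close> is an element of \<open>mspace X \<rightarrow> mspace Y\<close>; its values outside \<open>mspace X\<close>
  are irrelevant. Suprema and infima of distances and of quotients of distances are taken in
  \<open>[0, \<infinity>]\<close>, that is in \<open>ennreal\<close>, so that the supremum of the empty set is \<open>0\<close> and the infimum of
  the empty set is \<open>\<infinity>\<close>.
\<close>

definition coarse_modulus ::
  "'a metric \<Rightarrow> 'b metric \<Rightarrow> ('a \<Rightarrow> 'b) \<Rightarrow> real \<Rightarrow> ennreal" where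
  "coarse_modulus X Y f t =
     Sup {ennreal (mdist Y (f x) (f x')) | x x'.
            x \<in> mspace X \<and> x' \<in> mspace X \<and> mdist X x x' \<le> t}"

definition coarse_map :: "'a metric \<Rightarrow> 'b metric \<Rightarrow> ('a \<Rightarrow> 'b) \<Rightarrow> bool" where
  "coarse_map X Y f \<longleftrightarrow>
     f \<in> mspace X \<rightarrow> mspace Y \<and> (\<forall>t\<ge>0. coarse_modulus X Y f t < \<infinity>)"

definition coarse_Lipschitz :: "'a metric \<Rightarrow> 'b metric \<Rightarrow> ('a \<Rightarrow> 'b) \<Rightarrow> bool" where
  "coarse_Lipschitz X Y f \<longleftrightarrow>
     f \<in> mspace X \<rightarrow> mspace Y \<and>
     (\<exists>L>0. \<forall>t\<ge>0. coarse_modulus X Y f t \<le> ennreal (L * t + L))"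

definition close_maps ::
  "'a metric \<Rightarrow> 'b metric \<Rightarrow> ('a \<Rightarrow> 'b) \<Rightarrow> ('a \<Rightarrow> 'b) \<Rightarrow> bool" where
  "close_maps X Y f g \<longleftrightarrow> (SUP x\<in>mspace X. ennreal (mdist Y (f x) (g x))) < \<infinity>"

definition coarsely_equivalent :: "'a metric \<Rightarrow> 'b metric \<Rightarrow> bool" where
  "coarsely_equivalent X Y \<longleftrightarrow>
     (\<exists>f g. coarse_map X Y f \<and> coarse_map Y X g \<and>
            close_maps X X (g \<circ> f) id \<and> close_maps Y Y (f \<circ> g) id)"

definition coarse_Lipschitz_equivalence ::
  "'a metric \<Rightarrow> 'b metric \<Rightarrow> ('a \<Rightarrow> 'b) \<Rightarrow> bool" where
  "coarse_Lipschitz_equivalence X Y f \<longleftrightarrow>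
     coarse_Lipschitz X Y f \<and>
     (\<exists>g. coarse_Lipschitz Y X g \<and>
          close_maps X X (g \<circ> f) id \<and> close_maps Y Y (f \<circ> g) id)"

definition coarse_Lipschitz_embedding ::
  "'a metric \<Rightarrow> 'b metric \<Rightarrow> ('a \<Rightarrow> 'b) \<Rightarrow> bool" where
  "coarse_Lipschitz_embedding X Y f \<longleftrightarrow>
     f \<in> mspace X \<rightarrow> mspace Y \<and>
     coarse_Lipschitz_equivalence X (submetric Y (f ` mspace X)) f"

text \<open>
  The filter expresses \<open>x \<rightarrow> \<infinity>\<close> in \<open>X\<close>, that is \<open>mdist X x x0 \<rightarrow> \<infinity>\<close>. The first disjunct is the
  convention for bounded spaces (\<open>mbounded\<close> also holds for the empty space).
\<close>

definition asymptotically_close ::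
  "'a metric \<Rightarrow> 'b metric \<Rightarrow> ('a \<Rightarrow> 'b) \<Rightarrow> ('a \<Rightarrow> 'b) \<Rightarrow> bool" where
  "asymptotically_close X Y f g \<longleftrightarrow>
     Metric_space.mbounded (mspace X) (mdist X) (mspace X) \<or>
     (\<exists>x0\<in>mspace X.
        ((\<lambda>x. mdist Y (f x) (g x) / mdist X x x0) \<longlongrightarrow> 0)
          ((\<lambda>x. mdist X x x0) going_to at_top within mspace X))"

definition asymptotic_coarse_Lipschitz_inverse ::
  "'a metric \<Rightarrow> 'b metric \<Rightarrow> ('a \<Rightarrow> 'b) \<Rightarrow> ('b \<Rightarrow> 'a) \<Rightarrow> bool" where
  "asymptotic_coarse_Lipschitz_inverse X Y f g \<longleftrightarrow>
     coarse_Lipschitz Y X g \<and>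
     asymptotically_close X X (g \<circ> f) id \<and> asymptotically_close Y Y (f \<circ> g) id"

definition asymptotic_coarse_Lipschitz_equivalence ::
  "'a metric \<Rightarrow> 'b metric \<Rightarrow> ('a \<Rightarrow> 'b) \<Rightarrow> bool" where
  "asymptotic_coarse_Lipschitz_equivalence X Y f \<longleftrightarrow>
     coarse_Lipschitz X Y f \<and> (\<exists>g. asymptotic_coarse_Lipschitz_inverse X Y f g)"

definition Exp_at :: "'a metric \<Rightarrow> 'b metric \<Rightarrow> ('a \<Rightarrow> 'b) \<Rightarrow> real \<Rightarrow> ennreal" where
  "Exp_at X Z h s =
     Inf {ennreal (mdist Z (h x) (h z) / mdist X x z) | x z.
            x \<in> mspace X \<and> z \<in> mspace X \<and> mdist X x z \<ge> s}"

definition Exp_infinity :: "'a metric \<Rightarrow> 'b metric \<Rightarrow> ('a \<Rightarrow> 'b) \<Rightarrow> ennreal" where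
  "Exp_infinity X Z h = (SUP s\<in>{0<..}. Exp_at X Z h s)"

definition asydim_le :: "'a metric \<Rightarrow> nat \<Rightarrow> bool" where
  "asydim_le X n \<longleftrightarrow>
     (\<forall>r>0. \<exists>\<U> :: nat \<Rightarrow> 'a set set.
        mspace X = (\<Union>i\<le>n. \<Union>(\<U> i)) \<and>
        (\<forall>i\<le>n. \<forall>U\<in>\<U> i. \<forall>V\<in>\<U> i. U \<noteq> V \<longrightarrow>
           (INF x\<in>U. INF y\<in>V. ennreal (mdist X x y)) > ennreal r) \<and>
        (\<forall>i\<le>n. (SUP U\<in>\<U> i. SUP x\<in>U. SUP y\<in>U. ennreal (mdist X x y)) < \<infinity>))"

text \<open>The value is \<open>\<infinity>\<close> if no \<open>n\<close> qualifies.\<close>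

definition AsyDim :: "'a metric \<Rightarrow> enat" where
  "AsyDim X = Inf {enat n | n. asydim_le X n}"

end

theory Submission
  imports Defs "HOL-Real_Asymp.Real_Asymp"
begin

text \<open>
  For \<open>1 \<le> l \<le> k\<close> let the cell \<open>(k, l)\<close> consist of \<open>k\<close> points at mutual distance \<open>l\<close>. Put distinct
  cells of the same level \<open>k\<close> at distance \<open>k\<close>, and cells of different levels \<open>k, k'\<close> at distance
  \<open>\<bar>k\<^sup>2 - k'\<^sup>2\<bar>\<close>. Take the cells of even level for \<open>X\<close> and those of odd level for \<open>Y\<close>. Embedding the
  cell \<open>(k, l)\<close> into the cell \<open>(k + 1, l)\<close> gives bi-Lipschitz maps in both directions, whose composition
  moves the points of level \<open>k\<close>, which are at distance of order \<open>k\<^sup>2\<close> from the base point, by \<open>4 k + 4\<close>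
  only. A coarse equivalence, in contrast, preserves the number of points of a cell \<open>(k, l)\<close> once \<open>l\<close>
  exceeds a constant and \<open>k\<close> is large in terms of \<open>l\<close>, but no number is both even and odd.
\<close>

section \<open>Criteria with real constants for the coarse notions\<close>

lemma coarse_map_bound:
  assumes "coarse_map X Y f" "0 \<le> t"
  obtains B where "\<And>x x'. \<lbrakk>x \<in> mspace X; x' \<in> mspace X; mdist X x x' \<le> t\<rbrakk>
                     \<Longrightarrow> mdist Y (f x) (f x') \<le> B"
proof
  fix x x' assume "x \<in> mspace X" "x' \<in> mspace X" "mdist X x x' \<le> t"
  then have "ennreal (mdist Y (f x) (f x')) \<le> coarse_modulus X Y f t"
    unfolding coarse_modulus_def by (intro Sup_upper) auto
  moreover have "coarse_modulus X Y f t < \<infinity>"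
    using assms by (auto simp: coarse_map_def)
  ultimately show "mdist Y (f x) (f x') \<le> enn2real (coarse_modulus X Y f t)"
    by (metis enn2real_ennreal enn2real_mono infinity_ennreal_def mdist_nonneg)
qed

lemma close_maps_bound:
  assumes "close_maps X Y f g"
  obtains B where "\<And>x. x \<in> mspace X \<Longrightarrow> mdist Y (f x) (g x) \<le> B"
proof
  let ?S = "SUP x\<in>mspace X. ennreal (mdist Y (f x) (g x))"
  fix x assume "x \<in> mspace X"
  then have "ennreal (mdist Y (f x) (g x)) \<le> ?S"
    by (intro SUP_upper)
  with assms show "mdist Y (f x) (g x) \<le> enn2real ?S"
    unfolding close_maps_def
    by (metis enn2real_ennreal enn2real_mono infinity_ennreal_def mdist_nonneg)
qed

lemma coarse_Lipschitz_if_Lipschitz: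
  assumes "f \<in> mspace X \<rightarrow> mspace Y" "C > 0"
    and "\<And>x x'. \<lbrakk>x \<in> mspace X; x' \<in> mspace X\<rbrakk>
           \<Longrightarrow> mdist Y (f x) (f x') \<le> C * mdist X x x'"
  shows "coarse_Lipschitz X Y f"
  unfolding coarse_Lipschitz_def
proof (intro conjI exI[of _ C] allI impI)
  fix t :: real assume "0 \<le> t"
  show "coarse_modulus X Y f t \<le> ennreal (C * t + C)"
    unfolding coarse_modulus_def
  proof (rule Sup_least, clarify)
    fix x x' assume *: "x \<in> mspace X" "x' \<in> mspace X" "mdist X x x' \<le> t"
    then have "mdist Y (f x) (f x') \<le> C * mdist X x x'" by (intro assms)
    also have "\<dots> \<le> C * t + C"
      using * \<open>C > 0\<close> by (smt (verit) mult_left_mono)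
    finally show "ennreal (mdist Y (f x) (f x')) \<le> ennreal (C * t + C)"
      by (rule ennreal_leI)
  qed
qed (use assms in auto)

text \<open>The lower bound makes \<open>f\<close> injective and its inverse on the image Lipschitz
  with constant \<open>1 / c\<close>. Both compositions are exact identities, so the suprema
  measuring closeness are \<open>0\<close>.\<close>

lemma coarse_Lipschitz_embedding_if_bilipschitz:
  assumes f: "f \<in> mspace X \<rightarrow> mspace Y" and "C > 0"
    and upper: "\<And>x x'. \<lbrakk>x \<in> mspace X; x' \<in> mspace X\<rbrakk>
           \<Longrightarrow> mdist Y (f x) (f x') \<le> C * mdist X x x'"
    and "c > 0"
    and lower: "\<And>x x'. \<lbrakk>x \<in> mspace X; x' \<in> mspace X\<rbrakk>
           \<Longrightarrow> c * mdist X x x' \<le> mdist Y (f x) (f x')"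
  shows "coarse_Lipschitz_embedding X Y f"
proof -
  let ?Z = "submetric Y (f ` mspace X)"
  let ?g = "inv_into (mspace X) f"
  have Z: "mspace ?Z = f ` mspace X" using f by auto
  have inj: "inj_on f (mspace X)"
  proof (rule inj_onI)
    fix x x' assume *: "x \<in> mspace X" "x' \<in> mspace X" "f x = f x'"
    then have "c * mdist X x x' \<le> 0"
      using lower[of x x'] f by (metis Pi_mem mdist_zero)
    then show "x = x'"
      using * \<open>c > 0\<close> by (smt (verit) mdist_nonneg mdist_zero mult_pos_pos)
  qed
  have "coarse_Lipschitz X ?Z f"
    using f by (intro coarse_Lipschitz_if_Lipschitz[OF _ \<open>C > 0\<close>]) (auto simp: upper)
  moreover have "coarse_Lipschitz ?Z X ?g"
  proof (rule coarse_Lipschitz_if_Lipschitz[where C = "1 / c"])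
    fix y y' assume "y \<in> mspace ?Z" "y' \<in> mspace ?Z"
    then obtain x x' where "x \<in> mspace X" "x' \<in> mspace X" "y = f x" "y' = f x'"
      unfolding Z by auto
    then show "mdist X (?g y) (?g y') \<le> 1 / c * mdist ?Z y y'"
      using lower[of x x'] inj \<open>c > 0\<close> by (simp add: field_simps)
  qed (use \<open>c > 0\<close> Z in \<open>auto simp: inv_into_into\<close>)
  moreover have "close_maps X X (?g \<circ> f) id" "close_maps ?Z ?Z (f \<circ> ?g) id"
    unfolding close_maps_def Z using inj f
    by (auto simp: f_inv_into_f Pi_iff intro!: le_less_trans[OF SUP_least[of _ _ 0]])
  ultimately show ?thesis
    using f unfolding coarse_Lipschitz_embedding_def coarse_Lipschitz_equivalence_def by blast
qed

lemma asymptotically_close_if_sublinear: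
  assumes "x0 \<in> mspace X" and sublinear: "((\<lambda>t. \<phi> t / t) \<longlongrightarrow> 0) at_top"
    and bound: "\<And>x. x \<in> mspace X \<Longrightarrow> mdist Y (f x) (g x) \<le> \<phi> (mdist X x x0)"
  shows "asymptotically_close X Y f g"
proof -
  let ?F = "(\<lambda>x. mdist X x x0) going_to at_top within mspace X"
  have "((\<lambda>x. \<phi> (mdist X x x0) / mdist X x x0) \<longlongrightarrow> 0) ?F"
    by (rule filterlim_compose[OF sublinear filterlim_going_toI_weak])
  moreover have "eventually (\<lambda>x. x \<in> mspace X) ?F"
    by (simp add: going_to_within_def eventually_inf_principal)
  \<comment> \<open>At \<open>x = x0\<close> both quotients are \<open>0\<close>, since division by
    zero gives \<open>0\<close>, so the estimate holds on the whole space.\<close>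
  then have "eventually (\<lambda>x. norm (mdist Y (f x) (g x) / mdist X x x0)
               \<le> \<phi> (mdist X x x0) / mdist X x x0) ?F"
    by eventually_elim (use bound in \<open>auto intro!: divide_right_mono\<close>)
  ultimately have "((\<lambda>x. mdist Y (f x) (g x) / mdist X x x0) \<longlongrightarrow> 0) ?F"
    by (rule Lim_null_comparison[rotated])
  with assms(1) show ?thesis
    unfolding asymptotically_close_def by blast
qed

lemma Exp_infinity_pos_if_expanding:
  assumes "c > 0"
    and "\<And>x z. \<lbrakk>x \<in> mspace X; z \<in> mspace X\<rbrakk> \<Longrightarrow> c * mdist X x z \<le> mdist Z (h x) (h z)"
  shows "Exp_infinity X Z h > 0"
proof -
  have "0 < ennreal c" using assms(1) by simp
  \<comment> \<open>One value of \<open>s\<close> suffices for the supremum; \<open>s = 1\<close>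
    keeps the denominators positive.\<close>
  also have "ennreal c \<le> Exp_at X Z h 1"
    unfolding Exp_at_def
  proof (rule Inf_greatest, clarify)
    fix x z assume "x \<in> mspace X" "z \<in> mspace X" "mdist X x z \<ge> 1"
    then show "ennreal c \<le> ennreal (mdist Z (h x) (h z) / mdist X x z)"
      using assms(2)[of x z] by (intro ennreal_leI) (simp add: field_simps)
  qed
  also have "\<dots> \<le> Exp_infinity X Z h"
    unfolding Exp_infinity_def by (intro SUP_upper) auto
  finally show ?thesis .
qed

section \<open>Asymptotic dimension under bi-Lipschitz maps\<close>

text \<open>Covers of \<open>Y\<close> pull back along \<open>f\<close>: separation
  \<open>C * r\<close> becomes separation \<open>r\<close>, and a diameter bound \<open>b\<close>
  becomes \<open>b / c\<close>.\<close>

lemma asydim_le_bilipschitz: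
  assumes f: "f \<in> mspace X \<rightarrow> mspace Y" and C: "C > 0"
    and upper: "\<And>x x'. \<lbrakk>x \<in> mspace X; x' \<in> mspace X\<rbrakk>
           \<Longrightarrow> mdist Y (f x) (f x') \<le> C * mdist X x x'"
    and c: "c > 0"
    and lower: "\<And>x x'. \<lbrakk>x \<in> mspace X; x' \<in> mspace X\<rbrakk>
           \<Longrightarrow> c * mdist X x x' \<le> mdist Y (f x) (f x')"
    and Y: "asydim_le Y n"
  shows "asydim_le X n"
  unfolding asydim_le_def
proof (intro allI impI)
  fix r :: real assume "r > 0"
  with C have "C * r > 0" by simp
  with Y obtain V :: "nat \<Rightarrow> 'b set set" where
    cover: "mspace Y = (\<Union>i\<le>n. \<Union>(V i))" and
    sep: "\<forall>i\<le>n. \<forall>A\<in>V i. \<forall>B\<in>V i. A \<noteq> B \<longrightarrow>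
            (INF x\<in>A. INF y\<in>B. ennreal (mdist Y x y)) > ennreal (C * r)" and
    bdd: "\<forall>i\<le>n. (SUP A\<in>V i. SUP x\<in>A. SUP y\<in>A. ennreal (mdist Y x y)) < \<infinity>"
    unfolding asydim_le_def by (elim allE[of _ "C * r"] impE exE conjE)
  define pull where "pull A = f -` A \<inter> mspace X" for A
  have "mspace X = (\<Union>i\<le>n. \<Union>(pull ` V i))"
    using f[unfolded cover] by (auto simp: pull_def Pi_iff)
  moreover have "(INF x\<in>A. INF y\<in>B. ennreal (mdist X x y)) > ennreal r"
    if "i \<le> n" "A \<in> pull ` V i" "B \<in> pull ` V i" "A \<noteq> B" for i A B
  proof -
    from that obtain A' B' where *: "A' \<in> V i" "B' \<in> V i" "A = pull A'" "B = pull B'" "A' \<noteq> B'"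
      by blast
    let ?I = "INF x\<in>A'. INF y\<in>B'. ennreal (mdist Y x y)"
    have I: "?I > ennreal (C * r)" using *(5) by (intro sep[rule_format, OF that(1) *(1,2)])
    \<comment> \<open>Strict bounds on single distances give only a weak bound on their infimum. An
      intermediate value \<open>s\<close> keeps the separation strictly above
      \<open>r\<close>.\<close>
    obtain u where u: "ennreal (C * r) < u" "u < ?I" using dense[OF I] by (elim exE conjE)
    then obtain s where "u = ennreal s" "0 \<le> s" by (cases u) auto
    with u have s: "ennreal (C * r) < ennreal s" "ennreal s < ?I" "0 \<le> s" by simp_all
    have "r < s / C"
      using s C \<open>C * r > 0\<close> by (simp add: ennreal_less_iff field_simps)
    then have "ennreal r < ennreal (s / C)"
      using \<open>r > 0\<close> by (simp add: ennreal_less_iff)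
    also have "ennreal (s / C) \<le> (INF x\<in>A. INF y\<in>B. ennreal (mdist X x y))"
    proof (intro INF_greatest)
      fix x y assume "x \<in> A" "y \<in> B"
      with * have xy: "f x \<in> A'" "f y \<in> B'" "x \<in> mspace X" "y \<in> mspace X"
        by (auto simp: pull_def)
      have "?I \<le> ennreal (mdist Y (f x) (f y))"
        by (rule INF_lower2[OF xy(1)], rule INF_lower[OF xy(2)])
      with s have "ennreal s < ennreal (mdist Y (f x) (f y))" by order
      then have "s < mdist Y (f x) (f y)" using s by (simp add: ennreal_less_iff)
      also have "\<dots> \<le> C * mdist X x y"
        using xy by (intro upper)
      finally show "ennreal (s / C) \<le> ennreal (mdist X x y)"
        using C by (intro ennreal_leI) (simp add: field_simps)
    qed
    finally show ?thesis .
  qed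
  moreover have "(SUP A\<in>pull ` V i. SUP x\<in>A. SUP y\<in>A. ennreal (mdist X x y)) < \<infinity>"
    if "i \<le> n" for i
  proof -
    let ?S = "SUP A\<in>V i. SUP x\<in>A. SUP y\<in>A. ennreal (mdist Y x y)"
    have "?S < \<infinity>" using bdd that by blast
    then obtain b where b: "?S = ennreal b" "b \<ge> 0" by (cases ?S) auto
    have "(SUP A\<in>pull ` V i. SUP x\<in>A. SUP y\<in>A. ennreal (mdist X x y)) \<le> ennreal (b / c)"
    proof (intro SUP_least)
      fix A x y assume "A \<in> pull ` V i" "x \<in> A" "y \<in> A"
      then obtain A' where A': "A' \<in> V i"
        and xy: "f x \<in> A'" "f y \<in> A'" "x \<in> mspace X" "y \<in> mspace X"
        by (auto simp: pull_def)
      have "ennreal (mdist Y (f x) (f y)) \<le> ?S"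
        by (rule SUP_upper2[OF A'], rule SUP_upper2[OF xy(1)], rule SUP_upper[OF xy(2)])
      then have "mdist Y (f x) (f y) \<le> b" using b by simp
      with lower[of x y] have "c * mdist X x y \<le> b"
        using xy by simp
      then show "ennreal (mdist X x y) \<le> ennreal (b / c)"
        using c by (intro ennreal_leI) (simp add: field_simps)
    qed
    then show ?thesis by (simp add: order_le_less_trans)
  qed
  ultimately show "\<exists>\<U> :: nat \<Rightarrow> 'a set set.
        mspace X = (\<Union>i\<le>n. \<Union>(\<U> i)) \<and>
        (\<forall>i\<le>n. \<forall>U\<in>\<U> i. \<forall>V\<in>\<U> i. U \<noteq> V \<longrightarrow>
           (INF x\<in>U. INF y\<in>V. ennreal (mdist X x y)) > ennreal r) \<and>
        (\<forall>i\<le>n. (SUP U\<in>\<U> i. SUP x\<in>U. SUP y\<in>U. ennreal (mdist X x y)) < \<infinity>)"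
    by (intro exI[of _ "\<lambda>i. pull ` V i"] conjI allI impI ballI)
qed

section \<open>The metric space of cells\<close>

text \<open>The point \<open>i\<close> of the cell \<open>(k, l)\<close> is represented by the real number \<open>encode (k, l, i)\<close>.\<close>

definition encode :: "nat \<times> nat \<times> nat \<Rightarrow> real" where
  "encode p = real (to_nat p)"

definition decode :: "real \<Rightarrow> nat \<times> nat \<times> nat" where
  "decode x = from_nat (nat \<lfloor>x\<rfloor>)"

lemma decode_encode [simp]: "decode (encode p) = p"
  by (simp add: encode_def decode_def)

definition level :: "real \<Rightarrow> nat" where "level x = fst (decode x)"

definition scale :: "real \<Rightarrow> nat" where "scale x = fst (snd (decode x))"

definition points :: "real set" where
  "points = encode ` {(k, l, i). 1 \<le> l \<and> l \<le> k \<and> i < k}"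

text \<open>Across levels this is the distance on the line between the squares of the levels. By
  \<open>square_gap\<close> it is at least the sum of the two levels, so it dominates all distances
  inside either level.\<close>

definition cdist :: "real \<Rightarrow> real \<Rightarrow> real" where
  "cdist x y =
     (if x = y then 0
      else if level x \<noteq> level y then \<bar>(real (level x))\<^sup>2 - (real (level y))\<^sup>2\<bar>
      else if scale x \<noteq> scale y then real (level x)
      else real (scale x))"

definition cell :: "nat \<Rightarrow> nat \<Rightarrow> real set" where
  "cell k l = {x \<in> points. level x = k \<and> scale x = l}"

definition shift :: "real \<Rightarrow> real" where
  "shift x = (case decode x of (k, l, i) \<Rightarrow> encode (Suc k, l, i))"

lemma level_encode [simp]: "level (encode (k, l, i)) = k"
  by (simp add: level_def)

lemma scale_encode [simp]: "scale (encode (k, l, i)) = l"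
  by (simp add: scale_def)

lemma points_scale: "x \<in> points \<Longrightarrow> 1 \<le> scale x \<and> scale x \<le> level x"
  by (auto simp: points_def)

lemma card_cell:
  assumes "1 \<le> l" "l \<le> k"
  shows "card (cell k l) = k"
proof -
  have "cell k l = (\<lambda>i. encode (k, l, i)) ` {..<k}"
    using assms by (auto simp: cell_def points_def)
  moreover have "inj (\<lambda>i. encode (k, l, i))"
    by (rule injI) (metis decode_encode prod.inject)
  ultimately show ?thesis by (simp add: card_image inj_on_subset)
qed

lemma square_gap:
  fixes k m :: nat
  assumes "k \<noteq> m"
  shows "real (k + m) \<le> \<bar>(real k)\<^sup>2 - (real m)\<^sup>2\<bar>"
proof -
  have "1 \<le> \<bar>real k - real m\<bar>" using assms by linarith
  then have "1 * \<bar>real k + real m\<bar> \<le> \<bar>real k - real m\<bar> * \<bar>real k + real m\<bar>"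
    by (intro mult_right_mono) auto
  also have "\<bar>real k - real m\<bar> * \<bar>real k + real m\<bar> = \<bar>(real k)\<^sup>2 - (real m)\<^sup>2\<bar>"
    unfolding abs_mult[symmetric] by (simp add: power2_eq_square algebra_simps)
  finally show ?thesis by simp
qed

lemma cdist_other_level: "level x \<noteq> level y \<Longrightarrow> real (level x + level y) \<le> cdist x y"
  using square_gap[of "level x" "level y"] by (auto simp: cdist_def)

interpretation cells: Metric_space points cdist
proof
  show "0 \<le> cdist x y" for x y by (simp add: cdist_def)
  show "cdist x y = cdist y x" for x y by (auto simp: cdist_def)
  show "cdist x y = 0 \<longleftrightarrow> x = y" if "x \<in> points" "y \<in> points" for x y
    using points_scale[OF that(1)] by (auto simp: cdist_def)
  show "cdist x z \<le> cdist x y + cdist y z"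
    if "x \<in> points" "y \<in> points" "z \<in> points" for x y z
  \<comment> \<open>A detour through another level costs at least \<open>level x\<close> on one leg,
    which already bounds \<open>cdist x z\<close>. Otherwise all three points share a level, or
    \<open>x\<close> and \<open>z\<close> differ in level and the triangle inequality on the line
    applies.\<close>
  proof (cases "level x = level z \<and> level y \<noteq> level x")
    case True
    then have "cdist x z \<le> level x"
      using points_scale[OF that(1)] by (auto simp: cdist_def)
    with True cdist_other_level[of x y] cdist_other_level[of y z] show ?thesis by simp
  next
    case False
    then show ?thesis
      using points_scale[OF that(1)] points_scale[OF that(2)] points_scale[OF that(3)]
      unfolding cdist_def by (cases "level x = level y") auto
  qed
qed

definition level_space :: "nat set \<Rightarrow> real metric" where
  "level_space K = submetric (metric (points, cdist)) {x. level x \<in> K}"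

lemma mspace_level_space [simp]: "mspace (level_space K) = {x \<in> points. level x \<in> K}"
  by (auto simp: level_space_def)

lemma mdist_level_space [simp]: "mdist (level_space K) = cdist"
  by (simp add: level_space_def)

section \<open>Distance estimates by level and scale\<close>

lemma level_diff_le_cdist: "real (level x) \<le> real (level y) + cdist x y"
  using cdist_other_level[of x y] by (cases "level x = level y") auto

text \<open>Each nonzero value of \<open>cdist x y\<close> is bounded by part of the sum. Hence
  points of bounded level lie in a ball about any base point.\<close>

lemma cdist_le_levels:
  assumes "x \<in> points"
  shows "cdist x y \<le> (real (level x))\<^sup>2 + (real (level y))\<^sup>2 + real (level x)"
proof -
  have "\<bar>(real (level x))\<^sup>2 - (real (level y))\<^sup>2\<bar> \<le> (real (level x))\<^sup>2 + (real (level y))\<^sup>2"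
    using abs_triangle_ineq4[of "(real (level x))\<^sup>2" "(real (level y))\<^sup>2"] by simp
  moreover have "real (scale x) \<le> real (level x)" "0 \<le> (real (level x))\<^sup>2" "0 \<le> (real (level y))\<^sup>2"
    using points_scale[OF assms] by auto
  ultimately show ?thesis
    unfolding cdist_def by (smt (verit) of_nat_0_le_iff)
qed

text \<open>This isolates single points: a map that moves \<open>x\<close> by less than its scale
  fixes \<open>x\<close>.\<close>

lemma scale_le_cdist:
  assumes "x \<in> points" "x \<noteq> y"
  shows "real (scale x) \<le> cdist x y"
  using points_scale[OF assms(1)] cdist_other_level[of x y] assms(2)
  by (cases "level x = level y") (auto simp: cdist_def)

text \<open>This isolates whole cells: a displacement smaller than the level cannot leave the
  cell.\<close>

lemma level_le_cdist:
  assumes "x \<in> points" "y \<in> points" "y \<notin> cell (level x) (scale x)"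
  shows "real (level x) \<le> cdist x y"
  using cdist_other_level[of x y] assms
  by (cases "level x = level y") (auto simp: cdist_def cell_def)

lemma cdist_cell: "x \<in> cell k l \<Longrightarrow> y \<in> cell k l \<Longrightarrow> cdist x y \<le> real l"
  by (auto simp: cell_def cdist_def)

section \<open>The shift by one level\<close>

lemma shift_in_points: "x \<in> points \<Longrightarrow> shift x \<in> points"
  by (auto simp: points_def shift_def)

lemma level_shift [simp]: "level (shift x) = Suc (level x)"
  by (simp add: shift_def level_def split: prod.split)

lemma scale_shift [simp]: "scale (shift x) = scale x"
  by (simp add: shift_def scale_def split: prod.split)

lemma shift_eq_iff: "x \<in> points \<Longrightarrow> y \<in> points \<Longrightarrow> shift x = shift y \<longleftrightarrow> x = y"
  by (auto simp: points_def shift_def dest: arg_cong[where f = decode])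

lemma square_Suc_diff:
  fixes k m :: nat
  shows "\<bar>(real (Suc k))\<^sup>2 - (real (Suc m))\<^sup>2\<bar> = \<bar>(real k)\<^sup>2 - (real m)\<^sup>2\<bar> + 2 * \<bar>real k - real m\<bar>"
proof (induction k m rule: linorder_wlog)
  case (le k m)
  then have "(real k)\<^sup>2 \<le> (real m)\<^sup>2" by (intro power_mono) auto
  with le show ?case by (simp add: power2_eq_square algebra_simps)
qed (simp add: abs_minus_commute)

text \<open>Across levels the distance grows by \<open>2 * \<bar>k - m\<bar>\<close>, at most twice
  itself, whence the constant \<open>3\<close>. Within a level \<open>k \<ge> 1\<close> the scale is
  kept and \<open>k\<close> becomes \<open>k + 1 \<le> 2 * k\<close>.\<close>

lemma shift_bilipschitz:
  assumes "x \<in> points" "y \<in> points"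
  shows "cdist x y \<le> cdist (shift x) (shift y)" "cdist (shift x) (shift y) \<le> 3 * cdist x y"
proof -
  have "cdist x y \<le> cdist (shift x) (shift y) \<and> cdist (shift x) (shift y) \<le> 3 * cdist x y"
  proof (cases "level x = level y")
    case True
    with points_scale[OF assms(1)] shift_eq_iff[OF assms] show ?thesis
      by (auto simp: cdist_def)
  next
    case False
    moreover from False have "x \<noteq> y" "shift x \<noteq> shift y"
      by (auto dest: arg_cong[where f = level])
    moreover have "\<bar>real (level x) - real (level y)\<bar> \<le> \<bar>(real (level x))\<^sup>2 - (real (level y))\<^sup>2\<bar>"
      using square_gap[OF False] by linarith
    ultimately show ?thesis
      using square_Suc_diff[of "level x" "level y"] by (simp add: cdist_def del: of_nat_Suc)
  qed
  then show "cdist x y \<le> cdist (shift x) (shift y)" "cdist (shift x) (shift y) \<le> 3 * cdist x y"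
    by auto
qed

lemma shift_shift_asymptotically_close:
  assumes "x0 \<in> mspace (level_space K)" "level x0 \<le> 2"
  shows "asymptotically_close (level_space K) (level_space K) (shift \<circ> shift) id"
proof (rule asymptotically_close_if_sublinear[OF assms(1)])
  show "((\<lambda>t. 8 * sqrt (t + 4) / t) \<longlongrightarrow> 0) at_top"
    by real_asymp
  fix x assume "x \<in> mspace (level_space K)"
  then have x: "x \<in> points" by simp
  have "1 \<le> level x" using points_scale[OF x] by simp
  \<comment> \<open>With \<open>k = level x \<ge> 1\<close>, the displacement is
    \<open>(k + 2)^2 - k^2 = 4 * k + 4 \<le> 8 * k\<close>.\<close>
  then have "cdist (shift (shift x)) x \<le> 8 * real (level x)"
    by (auto simp: cdist_def power2_eq_square algebra_simps)
  \<comment> \<open>The summand \<open>4\<close> bounds the square of \<open>level x0\<close>, as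
    the base point has level at most \<open>2\<close>.\<close>
  also have "real (level x) \<le> sqrt (cdist x x0 + 4)"
  proof (rule real_le_rsqrt)
    have "(real (level x0))\<^sup>2 \<le> 2\<^sup>2" using assms(2) by (intro power_mono) auto
    moreover have "0 \<le> cdist x x0" by simp
    ultimately show "(real (level x))\<^sup>2 \<le> cdist x x0 + 4"
      by (cases "level x = level x0") (auto simp: cdist_def)
  qed
  finally show "mdist (level_space K) ((shift \<circ> shift) x) (id x) \<le> 8 * sqrt (mdist (level_space K) x x0 + 4)"
    by simp
qed

section \<open>Cell sizes as a coarse invariant\<close>

lemma infinite_nat_above:
  fixes K :: "nat set" and r :: real
  assumes "infinite K"
  obtains k where "k \<in> K" "r < real k"
  using assms by (metis infinite_nat_iff_unbounded less_trans of_nat_less_iff reals_Archimedean2)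

text \<open>For suitable \<open>l\<close> and \<open>k \<in> K\<close>, the map \<open>f\<close>
  restricts to a bijection from \<open>cell k l\<close> onto a cell of some level
  \<open>k' \<in> L\<close>, with inverse \<open>g\<close>. Counting points gives
  \<open>k = k'\<close>. The constants are chosen in the order \<open>l\<close>, \<open>M\<close>,
  \<open>R\<close>, \<open>k\<close>.\<close>

lemma coarsely_equivalent_common_level:
  assumes "coarsely_equivalent (level_space K) (level_space L)" "infinite K" "y0 \<in> mspace (level_space L)"
  shows "K \<inter> L \<noteq> {}"
proof -
  let ?X = "mspace (level_space K)" and ?Y = "mspace (level_space L)"
  from assms(1) obtain f g where
    f: "coarse_map (level_space K) (level_space L) f" and g: "coarse_map (level_space L) (level_space K) g" and
    gf: "close_maps (level_space K) (level_space K) (g \<circ> f) id" and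
    fg: "close_maps (level_space L) (level_space L) (f \<circ> g) id"
    unfolding coarsely_equivalent_def by blast
  have fX: "f x \<in> ?Y" if "x \<in> ?X" for x using f that unfolding coarse_map_def by auto
  have gY: "g y \<in> ?X" if "y \<in> ?Y" for y using g that unfolding coarse_map_def by auto
  obtain C1 where C1: "\<And>x. x \<in> ?X \<Longrightarrow> cdist (g (f x)) x \<le> C1"
    using close_maps_bound[OF gf] by (metis comp_apply id_apply mdist_level_space)
  obtain C2 where C2: "\<And>y. y \<in> ?Y \<Longrightarrow> cdist (f (g y)) y \<le> C2"
    using close_maps_bound[OF fg] by (metis comp_apply id_apply mdist_level_space)
  define C where "C = max 0 C2"
  have "0 \<le> C" by (simp add: C_def)
  obtain B1 where B1: "\<And>y y'. \<lbrakk>y \<in> ?Y; y' \<in> ?Y; cdist y y' \<le> C\<rbrakk> \<Longrightarrow> cdist (g y) (g y') \<le> B1"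
    using coarse_map_bound[OF g \<open>0 \<le> C\<close>] by (metis mdist_level_space)
  \<comment> \<open>Exceeding \<open>C1\<close> makes \<open>g \<circ> f\<close> the identity on
    cells of scale \<open>l\<close>; exceeding \<open>B1\<close> makes \<open>f\<close> separate
    their points by more than \<open>C\<close>; exceeding \<open>1\<close> ensures that the cell has
    two points.\<close>
  obtain l :: nat where l: "max 1 (max C1 B1) < real l"
    using reals_Archimedean2 by blast
  obtain M where M: "\<And>x x'. \<lbrakk>x \<in> ?X; x' \<in> ?X; cdist x x' \<le> real l\<rbrakk> \<Longrightarrow> cdist (f x) (f x') \<le> M"
    using coarse_map_bound[OF f, of "real l"] by (metis mdist_level_space of_nat_0_le_iff)
  define N where "N = max 0 M"
  have "0 \<le> N" by (simp add: N_def)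
  obtain B2 where B2: "\<And>y y'. \<lbrakk>y \<in> ?Y; y' \<in> ?Y; cdist y y' \<le> N\<rbrakk> \<Longrightarrow> cdist (g y) (g y') \<le> B2"
    using coarse_map_bound[OF g \<open>0 \<le> N\<close>] by (metis mdist_level_space)
  \<comment> \<open>By \<open>cdist_le_levels\<close>, the ball of radius \<open>R\<close> about
    \<open>y0\<close> contains all points of level at most \<open>N\<close>.\<close>
  define R where "R = N\<^sup>2 + (real (level y0))\<^sup>2 + N"
  have "0 \<le> R" using \<open>0 \<le> N\<close> by (simp add: R_def)
  obtain B3 where B3: "\<And>y y'. \<lbrakk>y \<in> ?Y; y' \<in> ?Y; cdist y y' \<le> R\<rbrakk> \<Longrightarrow> cdist (g y) (g y') \<le> B3"
    using coarse_map_bound[OF g \<open>0 \<le> R\<close>] by (metis mdist_level_space)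
  \<comment> \<open>The bound \<open>l\<close> makes the cell exist, \<open>B2\<close> keeps the
    values of \<open>g\<close> inside it, and the last bound forces its image to a level above
    \<open>N\<close>.\<close>
  obtain k where k: "k \<in> K" "max (real l) (max B2 (real (level (g y0)) + B3)) < real k"
    using infinite_nat_above[OF assms(2)] by blast
  have lk: "1 < l" "l < k" using l k by auto
  have cellX: "x \<in> ?X" if "x \<in> cell k l" for x
    using that k(1) by (auto simp: cell_def)
  have gf_id: "g (f x) = x" if "x \<in> cell k l" for x
  proof (rule ccontr)
    assume "g (f x) \<noteq> x"
    with that have "real l \<le> cdist x (g (f x))"
      using scale_le_cdist[of x "g (f x)"] by (auto simp: cell_def)
    with C1[OF cellX[OF that]] l show False by (simp add: cells.commute)
  qed
  have cardX: "card (cell k l) = k" using lk by (intro card_cell) auto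
  then have "\<not> card (cell k l) \<le> 1" using lk by simp
  then obtain x0 x1 where x01: "x0 \<in> cell k l" "x1 \<in> cell k l" "x0 \<noteq> x1"
    by (metis One_nat_def card_le_Suc0_iff_eq card.infinite le0)
  have f_far: "C < cdist (f x0) (f x1)"
  proof (rule ccontr)
    assume "\<not> C < cdist (f x0) (f x1)"
    then have "cdist x0 x1 \<le> B1"
      using B1[of "f x0" "f x1"] fX cellX x01 gf_id by (metis linorder_not_le)
    with scale_le_cdist[of x0 x1] x01 l show False by (auto simp: cell_def)
  qed
  define k' l' where "k' = level (f x0)" and "l' = scale (f x0)"
  have Y0: "f x0 \<in> ?Y" using fX cellX x01 by blast
  \<comment> \<open>Otherwise \<open>f x0\<close> is within \<open>R\<close> of \<open>y0\<close>,
    so \<open>x0 = g (f x0)\<close> is within \<open>B3\<close> of \<open>g y0\<close>, which is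
    impossible at level \<open>k\<close>.\<close>
  have k'_large: "N < real k'"
  proof (rule ccontr)
    assume "\<not> N < real k'"
    then have k'N: "real k' \<le> N" by simp
    then have "(real k')\<^sup>2 \<le> N\<^sup>2" by (intro power_mono) auto
    moreover have "cdist (f x0) y0 \<le> (real k')\<^sup>2 + (real (level y0))\<^sup>2 + real k'"
      using Y0 unfolding k'_def by (intro cdist_le_levels) simp
    ultimately have "cdist (f x0) y0 \<le> R"
      using k'N unfolding R_def by linarith
    with B3[of "f x0" y0] Y0 assms(3) gf_id[OF x01(1)] have "cdist x0 (g y0) \<le> B3"
      by simp
    with level_diff_le_cdist[of x0 "g y0"] x01 k(2) show False by (auto simp: cell_def)
  qed
  \<comment> \<open>Leaving the cell of \<open>f x0\<close> would cost at least
    \<open>k' > N\<close>, but the image of \<open>cell k l\<close> has diameter at most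
    \<open>M \<le> N\<close>.\<close>
  have f_cell: "f x \<in> cell k' l'" if "x \<in> cell k l" for x
  proof (rule ccontr)
    assume "f x \<notin> cell k' l'"
    then have "real k' \<le> cdist (f x0) (f x)"
      using level_le_cdist[of "f x0" "f x"] fX[OF cellX[OF that]] Y0
      by (auto simp: k'_def l'_def)
    moreover have "cdist (f x0) (f x) \<le> M"
      using M cellX that x01 cdist_cell by blast
    ultimately show False using k'_large by (simp add: N_def)
  qed
  \<comment> \<open>Distinct points of one cell are at distance exactly its scale, which traps
    \<open>l'\<close> between \<open>C\<close> and \<open>N\<close>. The lower bound serves
    \<open>fg_id\<close>, the upper one \<open>g_cell\<close>.\<close>
  have "cdist (f x0) (f x1) = real l'"
    using f_cell x01 f_far \<open>0 \<le> C\<close> by (auto simp: cell_def cdist_def split: if_splits)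
  moreover have "cdist (f x0) (f x1) \<le> M"
    using M cellX x01 cdist_cell by blast
  ultimately have l': "C < real l'" "real l' \<le> N" using f_far by (auto simp: N_def)
  have cellY: "y \<in> ?Y" if "y \<in> cell k' l'" for y
    using that Y0 by (auto simp: cell_def k'_def)
  have g_cell: "g y \<in> cell k l" if "y \<in> cell k' l'" for y
  proof (rule ccontr)
    assume "g y \<notin> cell k l"
    then have "real k \<le> cdist x0 (g y)"
      using level_le_cdist[of x0 "g y"] gY[OF cellY[OF that]] x01 by (auto simp: cell_def)
    moreover have "cdist (f x0) y \<le> N"
      using cdist_cell[OF f_cell[OF x01(1)] that] l' by simp
    then have "cdist x0 (g y) \<le> B2"
      using B2[OF Y0 cellY[OF that]] gf_id[OF x01(1)] by simp
    ultimately show False using k(2) by simp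
  qed
  have fg_id: "f (g y) = y" if "y \<in> cell k' l'" for y
  proof (rule ccontr)
    assume "f (g y) \<noteq> y"
    with that have "real l' \<le> cdist y (f (g y))"
      using scale_le_cdist[of y "f (g y)"] by (auto simp: cell_def)
    with C2[OF cellY[OF that]] l' show False by (simp add: cells.commute C_def)
  qed
  have "bij_betw f (cell k l) (cell k' l')"
    by (rule bij_betw_byWitness[where f' = g]) (use gf_id fg_id f_cell g_cell in auto)
  then have "card (cell k l) = card (cell k' l')" by (rule bij_betw_same_card)
  moreover have "card (cell k' l') = k'"
    using points_scale[of "f x0"] Y0 by (intro card_cell) (auto simp: k'_def l'_def)
  ultimately have "k = k'" using cardX by simp
  moreover have "k' \<in> L" using Y0 by (simp add: k'_def)
  ultimately show ?thesis using k(1) by blast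
qed

section \<open>Application to even and odd levels\<close>

lemma shift_space:
  assumes "\<And>k. k \<in> K \<Longrightarrow> Suc k \<in> L"
  shows "shift \<in> mspace (level_space K) \<rightarrow> mspace (level_space L)"
  using assms by (auto simp: shift_in_points)

text \<open>Stated for general \<open>K\<close> and \<open>L\<close> so as to cover both even to odd
  and odd to even.\<close>

lemma
  assumes "\<And>k. k \<in> K \<Longrightarrow> Suc k \<in> L"
  shows shift_coarse_Lipschitz: "coarse_Lipschitz (level_space K) (level_space L) shift"
    and shift_coarse_Lipschitz_embedding: "coarse_Lipschitz_embedding (level_space K) (level_space L) shift"
    and asydim_le_space: "asydim_le (level_space L) n \<Longrightarrow> asydim_le (level_space K) n"
proof -
  show "coarse_Lipschitz (level_space K) (level_space L) shift"
    using shift_space[OF assms] shift_bilipschitz(2)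
    by (intro coarse_Lipschitz_if_Lipschitz[where C = 3]) simp_all
  show "coarse_Lipschitz_embedding (level_space K) (level_space L) shift"
    using shift_space[OF assms] shift_bilipschitz
    by (intro coarse_Lipschitz_embedding_if_bilipschitz[where C = 3 and c = 1]) simp_all
  show "asydim_le (level_space K) n" if "asydim_le (level_space L) n"
    by (rule asydim_le_bilipschitz[where C = 3 and c = 1, OF shift_space[OF assms] _ _ _ _ that])
      (simp_all add: shift_bilipschitz)
qed

text \<open>The shift never decreases distances, so all quotients for
  \<open>shift \<circ> shift\<close> are at least \<open>1\<close>.\<close>

lemma shift_shift_Exp_infinity_pos: "Exp_infinity (level_space K) (level_space K) (shift \<circ> shift) > 0"
proof (rule Exp_infinity_pos_if_expanding[of 1])
  fix x z assume "x \<in> mspace (level_space K)" "z \<in> mspace (level_space K)"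
  then show "1 * mdist (level_space K) x z \<le> mdist (level_space K) ((shift \<circ> shift) x) ((shift \<circ> shift) z)"
    using shift_bilipschitz(1)[of x z] shift_bilipschitz(1)[of "shift x" "shift z"]
    by (simp add: shift_in_points)
qed simp

theorem proposition2p13:
  shows "\<exists>(X :: real metric) (Y :: real metric).
    \<not> coarsely_equivalent X Y \<and>
    (\<exists>f g. asymptotic_coarse_Lipschitz_equivalence X Y f \<and>
           asymptotic_coarse_Lipschitz_inverse X Y f g \<and>
           Exp_infinity Y Y (f \<circ> g) > 0 \<and>
           Exp_infinity X X (g \<circ> f) > 0 \<and>
           coarse_Lipschitz_embedding X Y f \<and>
           coarse_Lipschitz_embedding Y X g \<and>
           AsyDim X = AsyDim Y)"
proof -
  let ?X = "level_space {k. even k}" and ?Y = "level_space {k. odd k}"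
  \<comment> \<open>The base points have levels \<open>2\<close> and \<open>1\<close>, the lowest
    available ones: level \<open>0\<close> has no cell, because
    \<open>1 \<le> l \<le> k\<close>.\<close>
  have X0: "encode (2, 1, 0) \<in> mspace ?X" and Y0: "encode (1, 1, 0) \<in> mspace ?Y"
    by (auto simp: points_def)
  have "infinite {k::nat. even k}"
    unfolding infinite_nat_iff_unbounded_le by (metis dvd_triv_left le_add2 mem_Collect_eq mult_2)
  then have "\<not> coarsely_equivalent ?X ?Y"
    using coarsely_equivalent_common_level[OF _ _ Y0] by auto
  moreover have inverse: "asymptotic_coarse_Lipschitz_inverse ?X ?Y shift shift"
    unfolding asymptotic_coarse_Lipschitz_inverse_def
    by (intro conjI shift_coarse_Lipschitz shift_shift_asymptotically_close[OF X0]
        shift_shift_asymptotically_close[OF Y0]) auto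
  moreover have "asymptotic_coarse_Lipschitz_equivalence ?X ?Y shift"
    unfolding asymptotic_coarse_Lipschitz_equivalence_def
    using inverse shift_coarse_Lipschitz[of "{k. even k}" "{k. odd k}"] by auto
  \<comment> \<open>Each space embeds into the other by \<open>shift\<close>, so the dimensions
    agree without being computed.\<close>
  moreover have "asydim_le ?X n = asydim_le ?Y n" for n
    using asydim_le_space[of "{k. even k}" "{k. odd k}"] asydim_le_space[of "{k. odd k}" "{k. even k}"]
    by auto
  then have "AsyDim ?X = AsyDim ?Y" by (simp add: AsyDim_def)
  ultimately show ?thesis
    using shift_shift_Exp_infinity_pos shift_coarse_Lipschitz_embedding[of "{k. even k}" "{k. odd k}"]
      shift_coarse_Lipschitz_embedding[of "{k. odd k}" "{k. even k}"]
    by (intro exI[of _ ?X] exI[of _ ?Y] exI[of _ shift] conjI) auto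
qed

end
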